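(* Let $x_1,x_2,x_3,x_4\in\mathbb{R}^3$ be (coplanar) points which are the vertices of a convex quadrilateral. Then $|D(x_1,x_2,x_3,x_4)|\ge 1$.
   Context: $D$ denotes the Atiyah determinant, defined as follows. Let $x_1,\ldots,x_n$ be distinct points of $\mathbb{R}^3$, with $x_i=(x_{i,1},x_{i,2},x_{i,3})$. For each pair $i<j$ choose complex numbers $z_{i,j},w_{i,j}$ with $|z_{i,j}|^2+|w_{i,j}|^2=1$ and $$\frac{z_{i,j}}{w_{i,j}}=\frac{(x_{j,1}-x_{i,1})+(x_{j,2}-x_{i,2})\sqrt{-1}}{\sqrt{\sum_{k=1}^3(x_{j,k}-x_{i,k})^2}-(x_{j,3}-x_{i,3})},$$ with the convention that $w_{i,j}=0$ when the denominator of the right-hand side vanishes. For $i>j$ put $z_{i,j}=-\overline{w_{j,i}}$ and $w_{i,j}=\overline{z_{j,i}}$. Let $a_{i,j}$ be the coefficient of $t_1^{j-1}t_2^{n-j}$ in the polynomial $f_i(t_1,t_2)=\prod_{k\ne i}(z_{i,k}t_1-w_{i,k}t_2)$. Then $D(x_1,\ldots,x_n)=\det(a_{i,j})_{1\le i,j\le n}$; this number is known to be independent of the choices made. *)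

theory Defs
  imports
    "HOL-Analysis.Analysis"
    "HOL-Computational_Algebra.Polynomial"
    "Jordan_Normal_Form.Determinant"
begin

no_notation Matrix.vec_index (infixl "$" 100)

text \<open>
  Points \<open>x\<^sub>1, \<dots>, x\<^sub>n\<close> are the values of \<open>x :: nat \<Rightarrow> real ^ 3\<close> on \<open>{1..n}\<close>.
  Since division by zero yields zero in HOL, \<open>w i j \<noteq> 0\<close> has to be required explicitly
  when the denominator does not vanish.
\<close>

definition atiyah_choice ::
    "nat \<Rightarrow> (nat \<Rightarrow> real ^ 3) \<Rightarrow> (nat \<Rightarrow> nat \<Rightarrow> complex) \<Rightarrow> (nat \<Rightarrow> nat \<Rightarrow> complex) \<Rightarrow> bool"
  where
  "atiyah_choice n x z w \<longleftrightarrow>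
    (\<forall>i\<in>{1..n}. \<forall>j\<in>{1..n}. i < j \<longrightarrow>
       (let v = x j - x i; d = norm v - v $ 3 in
          (cmod (z i j))\<^sup>2 + (cmod (w i j))\<^sup>2 = 1 \<and>
          (if d = 0 then w i j = 0
           else w i j \<noteq> 0 \<and> z i j / w i j = Complex (v $ 1) (v $ 2) / complex_of_real d))) \<and>
    (\<forall>i\<in>{1..n}. \<forall>j\<in>{1..n}. j < i \<longrightarrow>
       z i j = - cnj (w j i) \<and> w i j = cnj (z j i))"

text \<open>
  A polynomial in \<open>t\<^sub>1, t\<^sub>2\<close> is a polynomial in \<open>t\<^sub>1\<close> whose coefficients are polynomials
  in \<open>t\<^sub>2\<close>; the linear factor below is \<open>z i k * t\<^sub>1 - w i k * t\<^sub>2\<close>.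
\<close>

definition atiyah_poly ::
    "nat \<Rightarrow> (nat \<Rightarrow> nat \<Rightarrow> complex) \<Rightarrow> (nat \<Rightarrow> nat \<Rightarrow> complex) \<Rightarrow> nat \<Rightarrow> complex poly poly"
  where
  "atiyah_poly n z w i = (\<Prod>k\<in>{1..n} - {i}. monom [:z i k:] 1 - [:monom (w i k) 1:])"

definition atiyah_coeff ::
    "nat \<Rightarrow> (nat \<Rightarrow> nat \<Rightarrow> complex) \<Rightarrow> (nat \<Rightarrow> nat \<Rightarrow> complex) \<Rightarrow> nat \<Rightarrow> nat \<Rightarrow> complex"
  where
  "atiyah_coeff n z w i j = coeff (coeff (atiyah_poly n z w i) (j - 1)) (n - j)"

text \<open>Matrix positions are counted from 0, points from 1.\<close>

definition atiyah_det ::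
    "nat \<Rightarrow> (nat \<Rightarrow> nat \<Rightarrow> complex) \<Rightarrow> (nat \<Rightarrow> nat \<Rightarrow> complex) \<Rightarrow> complex"
  where
  "atiyah_det n z w =
     Determinant.det (Matrix.mat n n (\<lambda>(i, j). atiyah_coeff n z w (i + 1) (j + 1)))"

text \<open>The vertices are the extreme points; \<open>aff_dim Q = 2\<close> makes them coplanar.\<close>

definition convex_quadrilateral :: "(real ^ 3) set \<Rightarrow> bool"
  where
  "convex_quadrilateral Q \<longleftrightarrow>
     polytope Q \<and> aff_dim Q = 2 \<and> card {v. v extreme_point_of Q} = 4"

end

theory Submission
  imports Defs
begin

text \<open>
  The pair \<open>(z i j, w i j)\<close> is a unit spinor whose image under the Hopf map is the unit vector
  from \<open>x i\<close> to \<open>x j\<close>. All these vectors are orthogonal to a unit normal \<open>n\<close> of the plane of the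
  quadrilateral. Written in an orthonormal basis of \<open>\<complex>\<^sup>2\<close> whose first vector is a spinor of \<open>n\<close>,
  the spinor \<open>(z i j, w i j)\<close> becomes \<open>\<beta> i j * (f i j, 1)\<close> with \<open>cmod (\<beta> i j) = 1 / sqrt 2\<close>, where the
  unit complex number \<open>f i j\<close> is the direction from \<open>x i\<close> to \<open>x j\<close> in an isometric copy of the plane
  inside \<open>\<complex>\<close> (\<open>spinor_in_plane\<close>). The change of basis multiplies the determinant by the sixth power of a
  number of modulus 1 and the twelve factors \<open>\<beta>\<close> contribute \<open>1 / 64\<close>, so \<open>64 * cmod D\<close> is the
  modulus of the determinant of the elementary symmetric functions of the \<open>f i j\<close>
  (\<open>cmod_atiyah_det_planar\<close>).

  That determinant is a unit times the real number \<open>planar_det\<close> (\<open>det_sym_row\<close>), which has the form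
  \<open>64 + 4 * \<Sigma> star * triangle - 8 * cross\<close>. For each vertex, \<open>star\<close> is 3 plus the cosines of
  the three angles there, and \<open>triangle\<close> is the sum of the cosines of the angles of the opposite triangle
  minus 1, that is, 4 times the product of the sines of the half angles. The term \<open>cross\<close> is the
  corresponding expression for the three products of opposite edges. This is a trigonometric form of
  the formula of Eastwood and Norbury, and it is symmetric in the four points.

  The diagonals of a convex quadrilateral \<open>ABCD\<close> cut its four angles into eight. In terms of these, every
  \<open>star\<close> is at least 2, because the two parts of an angle add up to the whole angle, which is below \<open>\<pi>\<close>.
  Moreover \<open>cross = - 4 * cos ((y - z) / 2) * sin (y / 2) * sin (z / 2)\<close>, where \<open>y\<close> and \<open>z\<close> are differences
  of two of the eight angles. It remains to bound \<open>- cos ((y - z) / 2) * sin (y / 2) * sin (z / 2)\<close> by the sum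
  of the four products of sines of half angles. If \<open>y\<close> and \<open>z\<close> have the
  same sign, that expression is not positive. If the signs are opposite, then \<open>cos ((y - z) / 2)\<close> is the sine of half the sum of two opposite angles of the quadrilateral, hence
  at most the sum of the sines of their halves, and the two triangles cut off at these two vertices have
  angles that dominate \<open>\<bar>y\<bar>\<close> and \<open>\<bar>z\<bar>\<close> (\<open>planar_det_eight_angles\<close>).
\<close>

section \<open>Sines and cosines of half angles\<close>

lemma cos_half_square:
  fixes x :: real
  shows "cos x = 2 * (cos (x/2))\<^sup>2 - 1"
  using cos_double_cos[of "x/2"] by simp

text \<open>
  The cosine sum of a triangle exceeds 1 by a positive product; this is what makes the \<open>triangle\<close> terms positive.
\<close>
lemma cos_triangle_half:
  fixes p q r :: real
  assumes "p + q + r = pi"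
  shows "cos p + cos q + cos r - 1 = 4 * sin (p/2) * sin (q/2) * sin (r/2)"
proof -
  have r: "r = pi - (p + q)" using assms by simp
  have "sin (r/2) = cos ((p + q)/2)"
    unfolding r by (simp add: sin_cos_eq field_simps)
  moreover have "cos ((p-q)/2) = cos ((p+q)/2) + 2 * sin (p/2) * sin (q/2)"
    using cos_diff[of "p/2" "q/2"] cos_add[of "p/2" "q/2"]
    by (simp add: add_divide_distrib diff_divide_distrib)
  moreover have "cos p + cos q = 2 * cos ((p+q)/2) * cos ((p-q)/2)"
    by (simp add: cos_plus_cos)
  moreover have "cos r = 1 - 2 * (cos ((p+q)/2))\<^sup>2"
    using cos_half_square[of "p+q"] unfolding r by simp
  ultimately show ?thesis by (simp add: power2_eq_square algebra_simps)
qed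

text \<open>
  By the sum-to-product formula the left-hand sum plus 1 is
  \<open>2 * cos ((p + q) / 2) * (cos ((p - q) / 2) + cos ((p + q) / 2))\<close>, and the bounds make all half angles acute.
  Here \<open>p\<close> and \<open>q\<close> are the two parts into which a diagonal cuts an angle of the quadrilateral.
\<close>
lemma cos_vertex:
  fixes p q :: real
  assumes "0 \<le> p" "0 \<le> q" "p + q \<le> pi"
  shows "-1 \<le> cos p + cos q + cos (p + q)"
proof -
  have 1: "cos p + cos q = 2 * (cos ((p+q)/2) * cos ((p-q)/2))"
    by (simp add: cos_plus_cos)
  have 2: "cos (p+q) = 2 * (cos ((p+q)/2))\<^sup>2 - 1" by (rule cos_half_square)
  have "0 \<le> cos ((p+q)/2)" "0 \<le> cos ((p-q)/2)"
    using assms by (auto intro!: cos_ge_zero)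
  then have "0 \<le> cos ((p+q)/2) * cos ((p-q)/2)" by simp
  then show ?thesis unfolding 1 2 by simp
qed

text \<open>
  \<open>cos_triangle_half\<close> for the signed angles \<open>- y\<close>, \<open>z\<close> and \<open>\<pi> + y - z\<close>.
\<close>
lemma cos_cross:
  fixes y z :: real
  shows "cos y + cos z - cos (y - z) - 1 = - 4 * cos ((y-z)/2) * sin (y/2) * sin (z/2)"
proof -
  have "sin ((pi + y - z) / 2) = cos ((y - z) / 2)"
    unfolding sin_cos_eq cos_minus[of "(y-z)/2", symmetric]
    by (rule arg_cong[where f=cos]) (simp add: field_simps)
  moreover have "cos (pi + y - z) = - cos (y - z)"
    using cos_periodic_pi2[of "y - z"] by (simp add: algebra_simps)
  ultimately show ?thesis
    using cos_triangle_half[of "-y" z "pi + y - z"] by simp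
qed

lemma sin_sum_le:
  fixes s t :: real
  assumes "0 \<le> s" "s \<le> pi" "0 \<le> t" "t \<le> pi"
  shows "sin (s + t) \<le> sin s + sin t"
proof -
  have "0 \<le> sin s" "0 \<le> sin t" using assms by (auto intro!: sin_ge_zero)
  then have "sin s * cos t \<le> sin s" "cos s * sin t \<le> sin t"
    by (auto intro: mult_left_le mult_left_le_one_le simp: mult.commute[of "cos s"])
  then show ?thesis by (simp add: sin_add)
qed

text \<open>
  The sine is subadditive on \<open>[0, \<pi>]\<close>, which splits the left-hand side into one summand for each of
  \<open>s\<close> and \<open>t\<close>; in each summand, \<open>y\<close> and \<open>z\<close> are replaced by larger angles, possibly different ones.
\<close>
lemma sin_half_product_le:
  fixes y z :: real
  assumes "0 \<le> y" "y \<le> p1" "y \<le> p2" "p1 \<le> pi" "p2 \<le> pi"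
     and "0 \<le> z" "z \<le> q1" "z \<le> q2" "q1 \<le> pi" "q2 \<le> pi"
     and "0 \<le> s" "s \<le> pi" "0 \<le> t" "t \<le> pi"
   shows "sin (y/2) * sin (z/2) * sin ((s+t)/2) \<le> 
    sin (p1/2) * sin (q1/2) * sin (s/2) + sin (p2/2) * sin (q2/2) * sin (t/2)"
proof -
  have mono: "sin (y/2) * sin (z/2) \<le> sin (p/2) * sin (q/2)" 
    if "y \<le> p" "p \<le> pi" "z \<le> q" "q \<le> pi" for p q
    using that assms by (intro mult_mono sin_monotone_2pi_le sin_ge_zero) auto
  have pos: "0 \<le> sin (y/2) * sin (z/2)" using assms by (intro mult_nonneg_nonneg sin_ge_zero) auto
  have "sin ((s+t)/2) \<le> sin (s/2) + sin (t/2)" 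
    using sin_sum_le[of "s/2" "t/2"] assms by (simp add: add_divide_distrib)
  then have "sin (y/2) * sin (z/2) * sin ((s+t)/2) \<le> sin (y/2) * sin (z/2) * (sin (s/2) + sin (t/2))"
    using pos by (rule mult_left_mono)
  also have "\<dots> = sin (y/2) * sin (z/2) * sin (s/2) + sin (y/2) * sin (z/2) * sin (t/2)"
    by (simp add: algebra_simps)
  also have "\<dots> \<le> sin (p1/2) * sin (q1/2) * sin (s/2) + sin (p2/2) * sin (q2/2) * sin (t/2)"
    using assms by (intro add_mono mult_right_mono mono sin_ge_zero) auto
  finally show ?thesis .
qed



section \<open>A symmetric function of four points in the plane\<close>

text \<open>
  In this section \<open>w i j\<close> stands for the unit complex number that points from point \<open>i\<close> to point \<open>j\<close>.
\<close>
definition vertex_cos :: "('i \<Rightarrow> 'i \<Rightarrow> complex) \<Rightarrow> 'i \<Rightarrow> 'i \<Rightarrow> 'i \<Rightarrow> real"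
  where "vertex_cos w l i j = inner (w l i) (w l j)"

definition star_term :: "('i \<Rightarrow> 'i \<Rightarrow> complex) \<Rightarrow> 'i \<Rightarrow> 'i \<Rightarrow> 'i \<Rightarrow> 'i \<Rightarrow> real"
  where "star_term w l i j k = 3 + vertex_cos w l i j + vertex_cos w l i k + vertex_cos w l j k"

definition triangle_term :: "('i \<Rightarrow> 'i \<Rightarrow> complex) \<Rightarrow> 'i \<Rightarrow> 'i \<Rightarrow> 'i \<Rightarrow> real"
  where "triangle_term w i j k = vertex_cos w i j k + vertex_cos w j i k + vertex_cos w k i j - 1"

text \<open>
  With \<open>w i j\<close> pointing from \<open>X i\<close> to \<open>X j\<close>, Ptolemy's identity turns the three products of opposite
  edges, as complex numbers, into the sides of a triangle. The three inner products are the cosines of its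
  angles; the sign of the last one accounts for the direction of the sides.
\<close>
definition cross_term :: "('i \<Rightarrow> 'i \<Rightarrow> complex) \<Rightarrow> 'i \<Rightarrow> 'i \<Rightarrow> 'i \<Rightarrow> 'i \<Rightarrow> real"
  where "cross_term w i j k l =
    inner (w i j * w k l) (w i k * w j l) + inner (w i l * w j k) (w i k * w j l)
    - inner (w i j * w k l) (w i l * w j k) - 1"

text \<open>
  For four points of a plane, the Atiyah determinant multiplied by 64, up to a factor of modulus 1; see
  \<open>det_sym_row\<close> and \<open>cmod_atiyah_det_planar\<close>.
\<close>
definition planar_det :: "('i \<Rightarrow> 'i \<Rightarrow> complex) \<Rightarrow> 'i \<Rightarrow> 'i \<Rightarrow> 'i \<Rightarrow> 'i \<Rightarrow> real"
  where "planar_det w i j k l = 64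
    + 4 * (star_term w i j k l * triangle_term w j k l + star_term w j i k l * triangle_term w i k l
         + star_term w k i j l * triangle_term w i j l + star_term w l i j k * triangle_term w i j k)
    - 8 * cross_term w i j k l"

lemma planar_det_swap12:
  assumes "\<And>i j. w j i = - w i j"
  shows "planar_det w j i k l = planar_det w i j k l"
  using assms[of j i] 
  by (simp add: planar_det_def star_term_def triangle_term_def cross_term_def vertex_cos_def inner_commute algebra_simps)

lemma planar_det_swap23:
  assumes "\<And>i j. w j i = - w i j"
  shows "planar_det w i k j l = planar_det w i j k l"
  using assms[of k j]
  by (simp add: planar_det_def star_term_def triangle_term_def cross_term_def vertex_cos_def inner_commute algebra_simps)

lemma planar_det_swap34:
  assumes "\<And>i j. w j i = - w i j"
  shows "planar_det w i j l k = planar_det w i j k l"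
  using assms[of l k]
  by (simp add: planar_det_def star_term_def triangle_term_def cross_term_def vertex_cos_def inner_commute algebra_simps)

text \<open>
  The three adjacent transpositions, used as permutative rewrite rules, sort the arguments.
\<close>
lemma planar_det_permute:
  fixes f :: "nat \<Rightarrow> nat \<Rightarrow> complex"
  assumes anti: "\<And>i j. f j i = - f i j" and ijkl: "{i, j, k, l} = {1, 2, 3, 4}"
  shows "planar_det f i j k l = planar_det f 1 2 3 4"
proof -
  have "i \<in> {1, 2, 3, 4}" "j \<in> {1, 2, 3, 4}" "k \<in> {1, 2, 3, 4}" "l \<in> {1, 2, 3, 4}"
    using ijkl by blast+
  moreover have "card {i, j, k, l} = 4" unfolding ijkl by simp
  then have "i \<noteq> j" "i \<noteq> k" "i \<noteq> l" "j \<noteq> k" "j \<noteq> l" "k \<noteq> l"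
    by (auto simp: card_insert_if split: if_splits)
  ultimately show ?thesis
    by (auto simp: planar_det_swap12[of f, OF anti] planar_det_swap23[of f, OF anti] planar_det_swap34[of f, OF anti])
qed

section \<open>Convex quadrilaterals in the complex plane\<close>

lemma inner_mult_cis:
  assumes "norm u = 1"
  shows "inner (u * cis x) (u * cis y) = cos (x - y)"
proof -
  have "(Re u)\<^sup>2 + (Im u)\<^sup>2 = 1" using assms by (simp add: cmod_def)
  moreover have "inner (u * cis x) (u * cis y) = ((Re u)\<^sup>2 + (Im u)\<^sup>2) * cos (x - y)"
    by (simp add: inner_complex_def cos_diff power2_eq_square algebra_simps)
  ultimately show ?thesis by simp
qed

text \<open>
  The diagonals \<open>AC\<close> and \<open>BD\<close> point in the directions \<open>u\<close> and \<open>v\<close>. At each vertex the suffix 1 or 2 tells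
  apart the two angles between the diagonal and the sides. The hypotheses \<open>sums\<close> are the
  angle sums of the four triangles into which the diagonals cut the quadrilateral.
\<close>
lemma planar_det_eight_angles:
  fixes a1 a2 b1 b2 c1 c2 d1 d2 \<theta> :: real
  assumes u: "norm u = 1" and v: "v = u * cis \<theta>"
    and sums: "a1 + b1 + \<theta> = pi" "c2 + d1 + \<theta> = pi" "b2 + c1 = \<theta>" "a2 + d2 = \<theta>"
    and pos: "a1 > 0" "a2 > 0" "b1 > 0" "b2 > 0" "c1 > 0" "c2 > 0" "d1 > 0" "d2 > 0"
    and A: "w A C = u" "w A B = u * cis (- a1)" "w A D = u * cis a2"
    and B: "w B D = v" "w B C = v * cis (- b2)" "w B A = v * cis b1"
    and C: "w C A = - u" "w C D = - u * cis (- c2)" "w C B = - u * cis c1"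
    and D: "w D B = - v" "w D A = - v * cis (- d2)" "w D C = - v * cis d1"
  shows "planar_det w A B C D \<ge> 64"
proof -
  have v1: "norm v = 1" using u v by (simp add: norm_mult)
  (* In a cyclic quadrilateral both differences vanish, by the inscribed angle theorem. *)
  define y z where "y = a1 - d1" and "z = b2 - a2"
  define SA SB SC SD where 
    "SA = sin (b2/2) * sin ((c1+c2)/2) * sin (d1/2)" and
    "SB = sin (a2/2) * sin (c2/2) * sin ((d1+d2)/2)" and
    "SC = sin ((a1+a2)/2) * sin (b1/2) * sin (d2/2)" and
    "SD = sin (a1/2) * sin ((b1+b2)/2) * sin (c1/2)"
  note [simp] = inner_mult_cis[OF u] inner_mult_cis[OF v1] 
     inner_mult_cis[OF u, where y=0, simplified] inner_mult_cis[OF v1, where y=0, simplified]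
     inner_mult_cis[OF u, where x=0, simplified] inner_mult_cis[OF v1, where x=0, simplified]
  have neg_cos: "cos (- s - t) = cos (t + s)" for s t :: real
    by (subst cos_minus[symmetric]) simp
  have star: "star_term w A B C D = 3 + (cos a1 + cos a2 + cos (a1 + a2))"
    "star_term w B A C D = 3 + (cos b1 + cos b2 + cos (b1 + b2))"
    "star_term w C A B D = 3 + (cos c1 + cos c2 + cos (c1 + c2))"
    "star_term w D A B C = 3 + (cos d1 + cos d2 + cos (d1 + d2))"
    unfolding star_term_def vertex_cos_def A B C D
    by (simp_all add: neg_cos algebra_simps)
  have star_ge: "star_term w A B C D \<ge> 2" "star_term w B A C D \<ge> 2" 
    "star_term w C A B D \<ge> 2" "star_term w D A B C \<ge> 2"
    unfolding star using cos_vertex[of a1 a2] cos_vertex[of b1 b2] cos_vertex[of c1 c2] cos_vertex[of d1 d2] 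
      sums pos by linarith+
  have "triangle_term w B C D = 4 * SA"
    unfolding SA_def
    using cos_triangle_half[of b2 "c1+c2" d1] sums
    by (simp add: triangle_term_def vertex_cos_def B C D neg_cos algebra_simps)
  moreover have "triangle_term w A C D = 4 * SB"
    unfolding SB_def
    using cos_triangle_half[of a2 "c2" "d1+d2"] sums
    by (simp add: triangle_term_def vertex_cos_def A C D neg_cos algebra_simps)
  moreover have "triangle_term w A B D = 4 * SC"
    unfolding SC_def
    using cos_triangle_half[of "a1+a2" "b1" d2] sums
    by (simp add: triangle_term_def vertex_cos_def A B D neg_cos algebra_simps)
  moreover have "triangle_term w A B C = 4 * SD"
    unfolding SD_def
    using cos_triangle_half[of "a1" "b1+b2" c1] sums
    by (simp add: triangle_term_def vertex_cos_def A B C neg_cos algebra_simps)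
  ultimately have det: "planar_det w A B C D = 64 + 4 * (star_term w A B C D * (4*SA) + star_term w B A C D * (4*SB)
     + star_term w C A B D * (4*SC) + star_term w D A B C * (4*SD)) - 8 * cross_term w A B C D"
    by (simp add: planar_det_def)
  have cross: "cross_term w A B C D = - 4 * cos ((y-z)/2) * sin (y/2) * sin (z/2)"
  proof -
    have uu: "norm (u * u) = 1" using u by (simp add: norm_mult)
    have cis_pi_minus: "cis (pi - t) = - cis (- t)" for t
      by (simp add: complex_eq_iff)
    have e: "w A B * w C D = (u * u) * cis (pi - (a1 + c2))"
       "w A C * w B D = (u * u) * cis \<theta>" 
       "w A D * w B C = (u * u) * cis (\<theta> + a2 - b2)"
      unfolding A B C v cis_pi_minus by (simp_all add: cis_mult algebra_simps)
    have "pi - (a1 + c2) - \<theta> = - y" "(\<theta> + a2 - b2) - \<theta> = - z" "pi - (a1 + c2) - (\<theta> + a2 - b2) = z - y"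
      using sums by (simp_all add: y_def z_def)
    then have "cross_term w A B C D = cos (- y) + cos (- z) - cos (z - y) - 1"
      unfolding cross_term_def e inner_mult_cis[OF uu] by (simp only:)
    moreover have "cos (z - y) = cos (y - z)" by (metis cos_minus minus_diff_eq)
    ultimately have "cross_term w A B C D = cos y + cos z - cos (y - z) - 1" by simp
    then show ?thesis using cos_cross by simp
  qed
  have S_nonneg: "SA \<ge> 0" "SB \<ge> 0" "SC \<ge> 0" "SD \<ge> 0"
    unfolding SA_def SB_def SC_def SD_def using sums pos
    by (auto intro!: mult_nonneg_nonneg sin_ge_zero)
  have cos_nonneg: "0 \<le> cos ((y-z)/2)" unfolding y_def z_def using sums pos by (intro cos_ge_zero) auto
  (* Each difference can be read off in two ways, which gives two upper bounds for its modulus. *)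
  have yeq: "y = c2 - b1" and zeq: "z = d2 - c1" using sums by (simp_all add: y_def z_def)
  have key: "0 \<le> SA + SB + SC + SD + cos ((y-z)/2) * sin (y/2) * sin (z/2)"
  proof (cases "y \<ge> 0"; cases "z \<ge> 0")
    assume "y \<ge> 0" "z \<ge> 0"
    then have "0 \<le> sin (y/2)" "0 \<le> sin (z/2)" using sums pos by (auto intro!: sin_ge_zero simp: y_def z_def)
    then show ?thesis using cos_nonneg S_nonneg by simp
  next
    assume "\<not> y \<ge> 0" "\<not> z \<ge> 0"
    then have "0 \<le> sin (-y/2)" "0 \<le> sin (-z/2)" using sums pos by (auto intro!: sin_ge_zero simp: y_def z_def)
    then have "0 \<le> sin (-y/2) * sin (-z/2)" by (rule mult_nonneg_nonneg)
    then show ?thesis using cos_nonneg S_nonneg by (simp add: mult.assoc)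
  next
    (* The angles at A and C are too large for a cyclic quadrilateral: the triangles at B and D dominate. *)
    assume "y \<ge> 0" "\<not> z \<ge> 0"
    then have "sin (y/2) * sin (-z/2) * sin (((b1+b2)+(d1+d2))/2) 
      \<le> sin (a1/2) * sin (c1/2) * sin ((b1+b2)/2) + sin (c2/2) * sin (a2/2) * sin ((d1+d2)/2)"
      using sums pos yeq zeq y_def z_def by (intro sin_half_product_le) linarith+
    moreover have "((b1+b2)+(d1+d2))/2 = pi/2 - (y - z)/2" 
      using sums by (simp add: y_def z_def field_simps)
    ultimately have "- sin (y/2) * sin (z/2) * cos ((y-z)/2) \<le> SD + SB"
      by (simp only: SD_def SB_def cos_sin_eq) (simp add: mult_ac)
    then show ?thesis using S_nonneg by (simp add: mult_ac)
  next
    (* The same with the roles of the two diagonals exchanged. *)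
    assume "\<not> y \<ge> 0" "z \<ge> 0"
    then have "sin (-y/2) * sin (z/2) * sin (((a1+a2)+(c1+c2))/2) 
      \<le> sin (b1/2) * sin (d2/2) * sin ((a1+a2)/2) + sin (d1/2) * sin (b2/2) * sin ((c1+c2)/2)"
      using sums pos yeq zeq y_def z_def by (intro sin_half_product_le) linarith+
    moreover have "((a1+a2)+(c1+c2))/2 = pi/2 - (z - y)/2" 
      using sums by (simp add: y_def z_def field_simps)
    moreover have "cos ((z - y)/2) = cos ((y - z)/2)"
      by (metis cos_minus minus_diff_eq minus_divide_left)
    ultimately have "- sin (y/2) * sin (z/2) * cos ((y-z)/2) \<le> SC + SA"
      by (simp only: SC_def SA_def cos_sin_eq) (simp add: mult_ac)
    then show ?thesis using S_nonneg by (simp add: mult_ac)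
  qed
  have "2 * SA \<le> star_term w A B C D * SA" "2 * SB \<le> star_term w B A C D * SB"
     "2 * SC \<le> star_term w C A B D * SC" "2 * SD \<le> star_term w D A B C * SD"
    using star_ge S_nonneg by (auto intro: mult_right_mono)
  then show ?thesis using key unfolding det cross by (simp add: mult.assoc)
qed

lemma Arg_upper_half_plane:
  assumes "Im r > 0"
  shows "0 < Arg r" "Arg r < pi" "sgn r = cis (Arg r)"
proof -
  have "r \<noteq> 0" using assms by auto
  then show "sgn r = cis (Arg r)" by (simp add: cis_Arg)
  show "0 < Arg r" using assms Arg_lt_pi[of r] by auto
  show "Arg r < pi" using assms Arg_lt_pi[of r] by auto
qed

lemma Im_divide_pos: "Im (q / p) > 0 \<longleftrightarrow> Im (q * cnj p) > 0" if "p \<noteq> 0"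
  using that by (simp add: Im_complex_div_gt_0)

text \<open>
  The positively oriented triangle with vertices \<open>0\<close>, \<open>p\<close>, \<open>q\<close>. Its angles are the arguments of the ratios of
  consecutive edges. These ratios have positive imaginary part and product \<open>- 1\<close>, so the sum of the angles
  is an odd multiple of \<open>\<pi>\<close> strictly between 0 and \<open>3 * \<pi>\<close>.
\<close>
lemma triangle_angles:
  fixes p q :: complex
  assumes pos: "Im (q * cnj p) > 0"
  obtains \<theta> \<alpha> \<beta> where "\<theta> > 0" "\<alpha> > 0" "\<beta> > 0" "\<theta> + \<alpha> + \<beta> = pi"
    "sgn q = sgn p * cis \<theta>" "sgn (q - p) = - sgn p * cis (- \<alpha>)" "sgn (p - q) = - sgn q * cis \<beta>"
proof -
  have nz: "p \<noteq> 0" "q \<noteq> 0" "q \<noteq> p" using pos by auto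
  define r1 r2 r3 where "r1 = q / p" and "r2 = (- p) / (q - p)" and "r3 = (p - q) / (- q)"
  have Im_pos: "Im r1 > 0" "Im r2 > 0" "Im r3 > 0"
    unfolding r1_def r2_def r3_def using pos nz
    by (subst Im_divide_pos; simp add: algebra_simps)+
  note A = Arg_upper_half_plane[OF Im_pos(1)] Arg_upper_half_plane[OF Im_pos(2)] Arg_upper_half_plane[OF Im_pos(3)]
  have "r1 * r2 * r3 = -1" unfolding r1_def r2_def r3_def using nz by (simp add: divide_simps) 
  then have "sgn r1 * sgn r2 * sgn r3 = -1" by (simp flip: sgn_mult)
  then have "cis (Arg r1 + Arg r2 + Arg r3) = -1" unfolding A by (simp add: cis_mult)
  then have "cos (Arg r1 + Arg r2 + Arg r3) = -1" by (metis cis.sel(1) one_complex.sel(1) uminus_complex.sel(1))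
  then obtain n :: int where n: "Arg r1 + Arg r2 + Arg r3 = (2 * real_of_int n + 1) * pi" 
    unfolding cos_eq_minus1 by blast
  have "0 < (2 * real_of_int n + 1) * pi" "(2 * real_of_int n + 1) * pi < 3 * pi" 
    unfolding n[symmetric] using A by linarith+
  then have "n = 0" by (simp add: zero_less_mult_iff)
  then have sum: "Arg r1 + Arg r2 + Arg r3 = pi" using n by simp
  have "p * r1 = q" "(q - p) * r2 = - p" "- q * r3 = p - q"
    using nz by (simp_all add: r1_def r2_def r3_def)
  then have sgns: "sgn q = sgn p * sgn r1" "- sgn p = sgn (q - p) * sgn r2" "sgn (p - q) = - sgn q * sgn r3"
    by (metis sgn_mult sgn_minus)+
  have "sgn (q - p) = - sgn p * cis (- Arg r2)"
    unfolding sgns(2) A(6) by (simp add: cis_mult)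
  then show ?thesis using that A sum sgns by metis
qed

lemma cis_inj_0_pi: 
  assumes "cis s = cis t" "0 < s" "s < pi" "0 < t" "t < pi"
  shows "s = t"
  using assms by (metis cis.sel(1) cos_inj_pi less_imp_le)

text \<open>
  The point \<open>e\<close> is the intersection of the diagonals. The eight angles arise by applying \<open>triangle_angles\<close>
  to the four triangles with apex \<open>e\<close>, translated so that \<open>e\<close> becomes 0.
\<close>
lemma planar_det_crossing_oriented:
  fixes X :: "'i \<Rightarrow> complex"
  assumes w: "\<And>i j. w i j = sgn (X j - X i)"
    and or: "Im (v * cnj u) > 0"
    and pos: "a > 0" "b > 0" "c > 0" "d > 0"
    and X: "X A = e - of_real a * u" "X B = e - of_real b * v" "X C = e + of_real c * u" "X D = e + of_real d * v"
  shows "planar_det w A B C D \<ge> 64"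
proof -
  have nz: "u \<noteq> 0" "v \<noteq> 0" using or by auto
  have anti: "w j i = - w i j" for i j unfolding w by (metis minus_diff_eq sgn_minus)
  define U V where "U = sgn u" and "V = sgn v"
  have sg: "sgn (- (of_real a * u)) = - U" "sgn (- (of_real b * v)) = - V"
     "sgn (of_real c * u) = U" "sgn (of_real d * v) = V"
    using pos by (simp_all add: U_def V_def sgn_minus sgn_mult sgn_of_real)
  have edges:
    "sgn (- (of_real a * u) - - (of_real b * v)) = w B A" "sgn (- (of_real b * v) - - (of_real a * u)) = w A B"
    "sgn (of_real c * u - - (of_real b * v)) = w B C" "sgn (- (of_real b * v) - of_real c * u) = w C B"
    "sgn (of_real d * v - of_real c * u) = w C D" "sgn (of_real c * u - of_real d * v) = w D C"
    "sgn (- (of_real a * u) - of_real d * v) = w D A" "sgn (of_real d * v - - (of_real a * u)) = w A D"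
    unfolding w X by ((rule arg_cong[where f = sgn], simp)+)
  have or': "Im v * Re u - Re v * Im u > 0" using or by (simp add: algebra_simps)
  obtain \<theta> a1 b1 where 1: "\<theta> > 0" "a1 > 0" "b1 > 0" "\<theta> + a1 + b1 = pi"
    "- V = - U * cis \<theta>" "w A B = U * cis (- a1)" "w B A = V * cis b1"
  proof (rule triangle_angles[of "- (of_real b * v)" "- (of_real a * u)", unfolded sg edges minus_minus])
    have "Im (- (of_real b * v) * cnj (- (of_real a * u))) = a * b * (Im v * Re u - Re v * Im u)"
      by (simp add: algebra_simps)
    then show "Im (- (of_real b * v) * cnj (- (of_real a * u))) > 0" using or' pos by simp
  qed (blast intro: that)
  obtain \<theta>2 b2 c1 where 2: "\<theta>2 > 0" "b2 > 0" "c1 > 0" "\<theta>2 + b2 + c1 = pi"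
    "U = - V * cis \<theta>2" "w B C = V * cis (- b2)" "w C B = - U * cis c1"
  proof (rule triangle_angles[of "of_real c * u" "- (of_real b * v)", unfolded sg edges minus_minus])
    have "Im (of_real c * u * cnj (- (of_real b * v))) = b * c * (Im v * Re u - Re v * Im u)"
      by (simp add: algebra_simps)
    then show "Im (of_real c * u * cnj (- (of_real b * v))) > 0" using or' pos by simp
  qed (blast intro: that)
  obtain \<theta>3 c2 d1 where 3: "\<theta>3 > 0" "c2 > 0" "d1 > 0" "\<theta>3 + c2 + d1 = pi"
    "V = U * cis \<theta>3" "w C D = - U * cis (- c2)" "w D C = - V * cis d1"
  proof (rule triangle_angles[of "of_real d * v" "of_real c * u", unfolded sg edges minus_minus])
    have "Im (of_real d * v * cnj (of_real c * u)) = c * d * (Im v * Re u - Re v * Im u)"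
      by (simp add: algebra_simps)
    then show "Im (of_real d * v * cnj (of_real c * u)) > 0" using or' pos by simp
  qed (blast intro: that)
  obtain \<theta>4 d2 a2 where 4: "\<theta>4 > 0" "d2 > 0" "a2 > 0" "\<theta>4 + d2 + a2 = pi"
    "- U = V * cis \<theta>4" "w D A = - V * cis (- d2)" "w A D = U * cis a2"
  proof (rule triangle_angles[of "- (of_real a * u)" "of_real d * v", unfolded sg edges minus_minus])
    have "Im (- (of_real a * u) * cnj (of_real d * v)) = a * d * (Im v * Re u - Re v * Im u)"
      by (simp add: algebra_simps)
    then show "Im (- (of_real a * u) * cnj (of_real d * v)) > 0" using or' pos by simp
  qed (blast intro: that)
  have nU: "norm U = 1" "norm V = 1" "U \<noteq> 0" "V \<noteq> 0" using nz by (auto simp: U_def V_def norm_sgn sgn_zero_iff)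
  have bounds: "0 < \<theta>" "\<theta> < pi" "0 < \<theta>2" "\<theta>2 < pi" "0 < \<theta>3" "\<theta>3 < pi" "0 < \<theta>4" "\<theta>4 < pi"
    using 1(1-4) 2(1-4) 3(1-4) 4(1-4) by linarith+
  have "U * cis \<theta> = U * cis \<theta>3" using 1(5) 3(5) by (metis minus_minus mult_minus_left)
  then have t3: "\<theta>3 = \<theta>" using nU bounds by (intro cis_inj_0_pi) simp_all
  have "V * cis \<theta>2 = V * cis \<theta>4" using 2(5) 4(5) by (metis minus_minus mult_minus_left)
  then have t4: "\<theta>4 = \<theta>2" using nU bounds by (intro cis_inj_0_pi) simp_all
  have V: "V = U * cis \<theta>" using 1(5) by (metis minus_minus mult_minus_left)
  have "V * cis (pi - \<theta>) = - (V * cis (- \<theta>))"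
    by (simp add: complex_eq_iff)
  also have "\<dots> = - U" unfolding V by (simp add: cis_mult mult.assoc)
  also have "\<dots> = V * cis \<theta>2" using 2(5) by simp
  finally have "cis (pi - \<theta>) = cis \<theta>2" using nU by simp
  then have t2: "pi - \<theta> = \<theta>2" using bounds by (intro cis_inj_0_pi) simp_all
  have AC: "w A C = U" and BD: "w B D = V"
  proof -
    have "X C - X A = of_real (a + c) * u" "X D - X B = of_real (b + d) * v"
      by (simp_all add: X algebra_simps)
    then show "w A C = U" "w B D = V" unfolding w using pos by (simp_all add: sgn_mult sgn_of_real U_def V_def del: of_real_add)
  qed
  have sums: "a1 + b1 + \<theta> = pi" "c2 + d1 + \<theta> = pi" "b2 + c1 = \<theta>" "a2 + d2 = \<theta>"
    using 1(4) 2(4) 3(4) 4(4) t2 t3 t4 by linarith+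
  have rev: "w C A = - U" "w D B = - V"
    using anti[of A C] anti[of B D] AC BD by simp_all
  show ?thesis
    by (rule planar_det_eight_angles[OF nU(1) V sums 1(2) 4(3) 1(3) 2(2) 2(3) 3(2) 3(3) 4(2)
      AC 1(6) 4(7) BD 2(6) 1(7) rev(1) 3(6) 2(7) rev(2) 4(6) 3(7)])
qed

text \<open>
  The other orientation is reached by exchanging \<open>B\<close> and \<open>D\<close>.
\<close>
lemma planar_det_crossing:
  fixes X :: "'i \<Rightarrow> complex"
  assumes w: "\<And>i j. w i j = sgn (X j - X i)"
    and or: "Im (v * cnj u) \<noteq> 0"
    and pos: "a > 0" "b > 0" "c > 0" "d > 0"
    and X: "X A = e - of_real a * u" "X B = e - of_real b * v" "X C = e + of_real c * u" "X D = e + of_real d * v"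
  shows "planar_det w A B C D \<ge> 64"
proof (cases "Im (v * cnj u) > 0")
  case True
  then show ?thesis using assms planar_det_crossing_oriented by metis
next
  case False
  then have "Im ((-v) * cnj u) > 0" using or by simp
  then have "planar_det w A D C B \<ge> 64"
    using planar_det_crossing_oriented[of w X "-v" u a d c b A e D C B] pos X w by simp
  moreover have anti: "w j i = - w i j" for i j unfolding w by (metis minus_diff_eq sgn_minus)
  have "planar_det w A D C B = planar_det w A B C D"
    by (metis anti planar_det_swap23 planar_det_swap34)
  ultimately show ?thesis by simp
qed

section \<open>Spinors of vectors in a plane\<close>

text \<open>
  The Hopf map sends the unit vector \<open>(z, w)\<close> of \<open>\<complex>\<^sup>2\<close> to the unit vector \<open>h\<close> of \<open>\<real>\<^sup>3\<close>; equivalently \<open>z / w\<close>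
  is the stereographic projection of \<open>h\<close>. In this form no division is involved and every equation is
  polynomial in \<open>z\<close>, \<open>w\<close> and their conjugates.
\<close>
definition spinor_of :: "complex \<Rightarrow> complex \<Rightarrow> real ^ 3 \<Rightarrow> bool"
  where "spinor_of z w h \<longleftrightarrow> z * cnj z + w * cnj w = 1 \<and> z * cnj z - w * cnj w = of_real (h $ 3)
    \<and> 2 * z * cnj w = Complex (h $ 1) (h $ 2)"

lemma norm_real3_square: "(norm (v :: real ^ 3))\<^sup>2 = (v $ 1)\<^sup>2 + (v $ 2)\<^sup>2 + (v $ 3)\<^sup>2"
  unfolding power2_norm_eq_inner inner_vec_def by (simp add: sum_3 power2_eq_square)

lemma Complex_mult_cnj: "Complex r s * cnj (Complex r s) = of_real (r\<^sup>2 + s\<^sup>2)"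
  by (simp add: complex_eq_iff power2_eq_square)

lemma spinor_of_sgn:
  fixes v :: "real ^ 3"
  assumes v: "v \<noteq> 0" and norm: "(cmod z)\<^sup>2 + (cmod w)\<^sup>2 = 1"
    and d: "d = norm v - v $ 3"
    and ratio: "if d = 0 then w = 0 else w \<noteq> 0 \<and> z / w = Complex (v $ 1) (v $ 2) / complex_of_real d"
  shows "spinor_of z w (sgn v)"
proof -
  define r where "r = norm v"
  have r: "r > 0" "v $ 3 = r - d" using v d by (auto simp: r_def)
  have sq: "(v $ 1)\<^sup>2 + (v $ 2)\<^sup>2 = d * (2 * r - d)"
    using norm_real3_square[of v] unfolding r_def[symmetric] r(2) by (simp add: power2_eq_square algebra_simps)
  have zw: "z * cnj z + w * cnj w = 1"
    using norm by (simp add: complex_norm_square[symmetric] del: of_real_power flip: of_real_add)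
  have comp: "sgn v $ k = v $ k / r" for k by (simp add: sgn_div_norm r_def divide_inverse)
  show ?thesis
  proof (cases "d = 0")
    case True
    then have "v $ 1 = 0" "v $ 2 = 0" using sq by (auto simp: sum_power2_eq_zero_iff)
    then show ?thesis using True ratio zw r by (simp add: spinor_of_def comp complex_eq_iff)
  next
    case False
    define C where "C = Complex (v $ 1) (v $ 2)"
    have CC: "C * cnj C = of_real (d * (2 * r - d))"
      unfolding C_def Complex_mult_cnj sq ..
    have z: "z = w * C / of_real d" 
    proof -
      have "w \<noteq> 0" "z / w = C / of_real d" using ratio False by (auto simp: C_def)
      then show ?thesis by (simp add: divide_eq_eq mult.commute)
    qed
    define W where "W = w * cnj w"
    have "z * cnj z = W * (C * cnj C) / (of_real d * of_real d)" by (simp add: z W_def)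
    also have "\<dots> = W * of_real (2 * r - d) / of_real d"
      unfolding CC using False by simp
    finally have zz: "z * cnj z = W * of_real (2 * r - d) / of_real d" .
    have "W * of_real (2 * r) = of_real d" 
      using zw False unfolding zz W_def[symmetric] by (simp add: field_simps)
    then have W: "W = of_real d / of_real (2 * r)" using r by (simp add: field_simps)
    have "2 * z * cnj w = 2 * W * C / of_real d" by (simp add: z W_def)
    also have "\<dots> = C / of_real r" using False r by (simp add: W)
    also have "\<dots> = Complex (sgn v $ 1) (sgn v $ 2)" unfolding comp C_def by (simp add: complex_eq_iff)
    finally have "2 * z * cnj w = Complex (sgn v $ 1) (sgn v $ 2)" .
    moreover have "z * cnj z - w * cnj w = of_real (sgn v $ 3)"
      unfolding zz W_def[symmetric] W comp r using False r(1) by (simp add: field_simps)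
    ultimately show ?thesis using zw by (simp add: spinor_of_def)
  qed
qed

lemma spinor_exists:
  fixes h :: "real ^ 3"
  assumes "norm h = 1"
  obtains z w where "spinor_of z w h"
proof -
  define d where "d = norm h - h $ 3"
  have h: "h \<noteq> 0" "sgn h = h" using assms by (auto simp: sgn_div_norm)
  have d2: "0 \<le> d" using component_le_norm_cart[of h 3] by (simp add: d_def)
  show ?thesis
  proof (cases "d = 0")
    case True
    then have "spinor_of 1 0 (sgn h)" using h by (intro spinor_of_sgn) (auto simp: d_def)
    then show ?thesis using h that by simp
  next
    case False
    (* The value of w is forced up to a phase: its square modulus is (1 - h $ 3) / 2. *)
    define w where "w = complex_of_real (sqrt (d / 2))"
    define z where "z = w * Complex (h $ 1) (h $ 2) / of_real d"
    have sq: "(h $ 1)\<^sup>2 + (h $ 2)\<^sup>2 = d * (2 - d)"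
      using norm_real3_square[of h] assms by (simp add: d_def power2_eq_square algebra_simps)
    have w2: "(cmod w)\<^sup>2 = d / 2" using d2 by (simp add: w_def norm_power[symmetric])
    have "(cmod z)\<^sup>2 = (cmod w)\<^sup>2 * (d * (2 - d)) / d\<^sup>2"
      unfolding z_def norm_mult norm_divide power_mult_distrib power_divide 
      by (simp add: cmod_power2 sq)
    also have "\<dots> = (2 - d) / 2" unfolding w2 using False by (simp add: power2_eq_square)
    finally have "(cmod z)\<^sup>2 + (cmod w)\<^sup>2 = 1" unfolding w2 by (simp add: field_simps)
    then have "spinor_of z w (sgn h)"
      using h False d2 by (intro spinor_of_sgn[OF _ _ d_def]) (auto simp: z_def w_def)
    then show ?thesis using h that by simp
  qed
qed

text \<open>
  Replacing \<open>(z, w)\<close> by \<open>(- cnj w, cnj z)\<close> changes the sign of the Hopf image. The convention for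
  \<open>j < i\<close> is therefore consistent with the direction from \<open>x i\<close> to \<open>x j\<close>.
\<close>
lemma atiyah_choice_spinor:
  assumes "atiyah_choice n x z w" "i \<in> {1..n}" "j \<in> {1..n}" "i \<noteq> j" "x i \<noteq> x j"
  shows "spinor_of (z i j) (w i j) (sgn (x j - x i))"
proof -
  have *: "spinor_of (z i j) (w i j) (sgn (x j - x i))" 
    if "i < j" "i \<in> {1..n}" "j \<in> {1..n}" "x i \<noteq> x j" for i j
    using that assms(1) unfolding atiyah_choice_def Let_def
    by (intro spinor_of_sgn[OF _ _ refl]) auto
  show ?thesis
  proof (cases "i < j")
    case True
    then show ?thesis using * assms by blast
  next
    case False
    then have "j < i" using assms by simp
    then have s: "spinor_of (z j i) (w j i) (sgn (x i - x j))" using * assms by metis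
    have zw: "z i j = - cnj (w j i)" "w i j = cnj (z j i)" 
      using assms \<open>j < i\<close> by (auto simp: atiyah_choice_def)
    have m: "sgn (x j - x i) = - sgn (x i - x j)" by (metis minus_diff_eq sgn_minus)
    show ?thesis using s unfolding zw m spinor_of_def 
      by (simp add: complex_eq_iff algebra_simps)
  qed
qed

text \<open>
  If \<open>(p, q)\<close> is a spinor of the unit vector \<open>n\<close>, the rotation of \<open>\<real>\<^sup>3\<close> that corresponds to the unitary matrix
  with rows \<open>(cnj p, cnj q)\<close> and \<open>(- q, p)\<close> takes \<open>n\<close> to the third unit vector. This map gives the first two
  coordinates of the rotated vector, as one complex number.
\<close>
definition plane_coord :: "complex \<Rightarrow> complex \<Rightarrow> real ^ 3 \<Rightarrow> complex"
  where "plane_coord p q v = (cnj p)\<^sup>2 * Complex (v $ 1) (v $ 2) - (cnj q)\<^sup>2 * cnj (Complex (v $ 1) (v $ 2))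
    - 2 * cnj p * cnj q * of_real (v $ 3)"

lemma linear_plane_coord: "linear (plane_coord p q)"
proof (rule linearI)
  fix u v :: "real ^ 3" and c :: real
  have "Complex ((u + v) $ k) ((u + v) $ l) = Complex (u $ k) (u $ l) + Complex (v $ k) (v $ l)"
    "Complex ((c *\<^sub>R v) $ k) ((c *\<^sub>R v) $ l) = of_real c * Complex (v $ k) (v $ l)" for k l
    by (simp_all add: complex_eq_iff)
  then show "plane_coord p q (u + v) = plane_coord p q u + plane_coord p q v"
    "plane_coord p q (c *\<^sub>R v) = c *\<^sub>R plane_coord p q v"
    unfolding plane_coord_def by (simp_all add: scaleR_conv_of_real[where 'a=complex] algebra_simps)
qed

text \<open>
  The unitary change of coordinates takes a spinor of \<open>h\<close> to a spinor of the rotated vector, whose first two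
  coordinates are \<open>plane_coord p q h\<close> and whose third coordinate is \<open>inner n h\<close>.
\<close>
lemma spinor_coordinates:
  assumes s: "spinor_of z w h" and p: "spinor_of p q n"
    and \<alpha>: "\<alpha> = cnj p * z + cnj q * w" and \<beta>: "\<beta> = p * w - q * z"
  shows "z = \<alpha> * p - \<beta> * cnj q" "w = \<alpha> * q + \<beta> * cnj p"
    and "2 * \<alpha> * cnj \<beta> = plane_coord p q h"
    and "\<alpha> * cnj \<alpha> + \<beta> * cnj \<beta> = 1"
    and "\<alpha> * cnj \<alpha> - \<beta> * cnj \<beta> = of_real (inner n h)"
proof -
  define H where "H = Complex (h $ 1) (h $ 2)"
  define N where "N = Complex (n $ 1) (n $ 2)"
  have s': "z * cnj z + w * cnj w = 1" "z * cnj z - w * cnj w = of_real (h $ 3)" "2 * z * cnj w = H"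
    using s by (auto simp: spinor_of_def H_def)
  have p': "p * cnj p + q * cnj q = 1" "p * cnj p - q * cnj q = of_real (n $ 3)" "2 * p * cnj q = N"
    using p by (auto simp: spinor_of_def N_def)
  have "\<alpha> * p - \<beta> * cnj q = z * (p * cnj p + q * cnj q)" by (simp add: \<alpha> \<beta> algebra_simps)
  then show "z = \<alpha> * p - \<beta> * cnj q" using p' by simp
  have "\<alpha> * q + \<beta> * cnj p = w * (p * cnj p + q * cnj q)" by (simp add: \<alpha> \<beta> algebra_simps)
  then show "w = \<alpha> * q + \<beta> * cnj p" using p' by simp
  have "2 * \<alpha> * cnj \<beta> = (cnj p)\<^sup>2 * (2 * z * cnj w) - (cnj q)\<^sup>2 * cnj (2 * z * cnj w) 
     - 2 * cnj p * cnj q * (z * cnj z - w * cnj w)"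
    by (simp add: \<alpha> \<beta> algebra_simps power2_eq_square)
  then show "2 * \<alpha> * cnj \<beta> = plane_coord p q h" unfolding s' by (simp add: plane_coord_def H_def)
  have "\<alpha> * cnj \<alpha> + \<beta> * cnj \<beta> = (p * cnj p + q * cnj q) * (z * cnj z + w * cnj w)"
    by (simp add: \<alpha> \<beta> algebra_simps)
  then show "\<alpha> * cnj \<alpha> + \<beta> * cnj \<beta> = 1" unfolding s' p' by simp
  have "2 * (\<alpha> * cnj \<alpha> - \<beta> * cnj \<beta>) = 2 * (p * cnj p - q * cnj q) * (z * cnj z - w * cnj w)
     + (2 * p * cnj q) * cnj (2 * z * cnj w) + cnj (2 * p * cnj q) * (2 * z * cnj w)"
    by (simp add: \<alpha> \<beta> algebra_simps)
  also have "\<dots> = 2 * of_real (inner n h)"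
    unfolding s' p' N_def H_def by (simp add: complex_eq_iff inner_vec_def sum_3 algebra_simps)
  finally show "\<alpha> * cnj \<alpha> - \<beta> * cnj \<beta> = of_real (inner n h)" by (simp only: mult_cancel_left) simp
qed

text \<open>
  When \<open>h\<close> is orthogonal to \<open>n\<close>, the coordinates \<open>\<alpha>\<close> and \<open>\<beta>\<close> have equal moduli, so \<open>\<alpha> / \<beta>\<close> has modulus 1 and equals
  \<open>2 * \<alpha> * cnj \<beta>\<close>.
\<close>
lemma spinor_in_plane:
  assumes s: "spinor_of z w h" and p: "spinor_of p q n" and perp: "inner n h = 0"
  obtains \<beta> where "cmod \<beta> = 1 / sqrt 2" "cmod (plane_coord p q h) = 1"
    "z = \<beta> * (plane_coord p q h * p - cnj q)" "w = \<beta> * (plane_coord p q h * q + cnj p)"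
proof -
  define \<alpha> \<beta> where "\<alpha> = cnj p * z + cnj q * w" and "\<beta> = p * w - q * z"
  note c = spinor_coordinates[OF s p \<alpha>_def \<beta>_def]
  have eq: "\<alpha> * cnj \<alpha> = \<beta> * cnj \<beta>" using c(5) perp by simp
  then have half: "\<beta> * cnj \<beta> = 1/2" "\<alpha> * cnj \<alpha> = 1/2" using c(4) by (simp_all add: field_simps)
  have "complex_of_real ((cmod \<beta>)\<^sup>2) = of_real (1/2)" "complex_of_real ((cmod \<alpha>)\<^sup>2) = of_real (1/2)" 
    by (simp_all only: complex_norm_square half) simp_all
  then have sq: "(cmod \<beta>)\<^sup>2 = 1/2" "(cmod \<alpha>)\<^sup>2 = 1/2" using of_real_eq_iff by blast+
  then have b: "cmod \<beta> = 1 / sqrt 2" "cmod \<alpha> = 1 / sqrt 2"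
    by (metis norm_ge_zero real_sqrt_divide real_sqrt_one real_sqrt_unique)+
  have "plane_coord p q h * \<beta> = 2 * \<alpha> * (\<beta> * cnj \<beta>)" unfolding c(3)[symmetric] by simp
  then have a: "\<alpha> = plane_coord p q h * \<beta>" unfolding half by simp
  show ?thesis
  proof
    show "cmod \<beta> = 1 / sqrt 2" by fact
    show "cmod (plane_coord p q h) = 1" unfolding c(3)[symmetric] by (simp add: norm_mult b)
    show "z = \<beta> * (plane_coord p q h * p - cnj q)" using c(1) unfolding a by (simp add: algebra_simps)
    show "w = \<beta> * (plane_coord p q h * q + cnj p)" using c(2) unfolding a by (simp add: algebra_simps)
  qed
qed

text \<open>
  Every direction has a spinor, so \<open>spinor_in_plane\<close> applies to the normalization of \<open>v\<close>.
\<close>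
lemma norm_plane_coord:
  assumes p: "spinor_of p q n" and perp: "inner n v = 0"
  shows "cmod (plane_coord p q v) = norm v"
proof (cases "v = 0")
  case True
  then show ?thesis by (simp add: linear_0[OF linear_plane_coord])
next
  case False
  then obtain z w where s: "spinor_of z w (sgn v)" using spinor_exists[of "sgn v"] by (auto simp: norm_sgn)
  have "inner n (sgn v) = 0" using perp by (simp add: sgn_div_norm)
  then have "cmod (plane_coord p q (sgn v)) = 1" using spinor_in_plane[OF s p] by blast
  then show ?thesis using False by (simp add: sgn_div_norm linear_cmul[OF linear_plane_coord] field_simps)
qed

lemma plane_coord_sgn:
  assumes p: "spinor_of p q n" and perp: "inner n v = 0"
  shows "plane_coord p q (sgn v) = sgn (plane_coord p q v)"
  using norm_plane_coord[OF assms] by (simp add: sgn_div_norm linear_cmul[OF linear_plane_coord])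

section \<open>The determinant in an adapted basis\<close>

text \<open>
  Laplace expansion along the first two rows.
\<close>
lemma det_mat_4:
  fixes f :: "nat \<Rightarrow> nat \<Rightarrow> 'a :: comm_ring_1"
  shows "Determinant.det (Matrix.mat 4 4 (\<lambda>(i, j). f i j)) =
    (f 0 0 * f 1 1 - f 0 1 * f 1 0) * (f 2 2 * f 3 3 - f 2 3 * f 3 2)
  - (f 0 0 * f 1 2 - f 0 2 * f 1 0) * (f 2 1 * f 3 3 - f 2 3 * f 3 1)
  + (f 0 0 * f 1 3 - f 0 3 * f 1 0) * (f 2 1 * f 3 2 - f 2 2 * f 3 1)
  + (f 0 1 * f 1 2 - f 0 2 * f 1 1) * (f 2 0 * f 3 3 - f 2 3 * f 3 0)
  - (f 0 1 * f 1 3 - f 0 3 * f 1 1) * (f 2 0 * f 3 2 - f 2 2 * f 3 0)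
  + (f 0 2 * f 1 3 - f 0 3 * f 1 2) * (f 2 0 * f 3 1 - f 2 1 * f 3 0)"
  apply (subst laplace_expansion_row[where n=4 and i=0])
    apply (simp_all add: cofactor_def mat_delete_def eval_nat_numeral)
  apply (subst laplace_expansion_row[where n="Suc(Suc(Suc 0))" and i=0], simp, simp)+
  apply (simp add: cofactor_def mat_delete_def )
  apply (subst laplace_expansion_row[where n="Suc(Suc 0)" and i=0], simp, simp)+
  apply (simp add: cofactor_def mat_delete_def det_single)
  apply (simp add: algebra_simps)
  done

text \<open>
  The coefficient of \<open>t1 ^ j * t2 ^ (3 - j)\<close> in the product of the linear forms \<open>zk * t1 - wk * t2\<close>.
\<close>
definition cubic_coeff :: "complex \<Rightarrow> complex \<Rightarrow> complex \<Rightarrow> complex \<Rightarrow> complex \<Rightarrow> complex \<Rightarrow> nat \<Rightarrow> complex"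
  where "cubic_coeff z1 w1 z2 w2 z3 w3 j =
    (if j = 0 then - (w1 * w2 * w3)
     else if j = 1 then z1 * w2 * w3 + w1 * z2 * w3 + w1 * w2 * z3
     else if j = 2 then - (z1 * z2 * w3 + z1 * w2 * z3 + w1 * z2 * z3)
     else z1 * z2 * z3)"

lemma less_4_cases: "j < 4 \<Longrightarrow> j = 0 \<or> j = 1 \<or> j = 2 \<or> j = (3::nat)"
  by auto

lemma linear_factor: "monom [:z:] 1 - [:monom w 1:] = [:[:0, -w:], [:z:]:]" for z w :: complex
  by (simp add: monom_Suc monom_0)

lemma atiyah_coeff_cubic:
  assumes "{1..4} - {i} = {k, l, m}" "distinct [k, l, m]" "j < 4"
  shows "atiyah_coeff 4 z w i (j + 1) = cubic_coeff (z i k) (w i k) (z i l) (w i l) (z i m) (w i m) j"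
proof -
  have "atiyah_poly 4 z w i = [:[:0, -w i k:], [:z i k:]:] * ([:[:0, -w i l:], [:z i l:]:] * [:[:0, -w i m:], [:z i m:]:])"
    using assms(2) unfolding atiyah_poly_def assms(1) linear_factor by simp
  then show ?thesis
    using less_4_cases[OF assms(3)] unfolding atiyah_coeff_def
    by (auto simp: cubic_coeff_def numeral_3_eq_3 numeral_2_eq_2 algebra_simps)
qed

text \<open>
  The elementary symmetric functions of three numbers, of degrees 3, 2, 1, 0.
\<close>
definition sym_coeff :: "complex \<Rightarrow> complex \<Rightarrow> complex \<Rightarrow> nat \<Rightarrow> complex"
  where "sym_coeff r s t m =
    (if m = 0 then r * s * t else if m = 1 then r * s + s * t + r * t
     else if m = 2 then r + s + t else 1)"

text \<open>
  The cubic forms \<open>P ^ (3 - m) * R ^ m\<close> for \<open>P = a * t1 - c * t2\<close> and \<open>R = b * t1 - d * t2\<close>.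
\<close>
definition basis_coeff :: "complex \<Rightarrow> complex \<Rightarrow> complex \<Rightarrow> complex \<Rightarrow> nat \<Rightarrow> nat \<Rightarrow> complex"
  where "basis_coeff a b c d m = 
    (if m = 0 then cubic_coeff a c a c a c else if m = 1 then cubic_coeff a c a c b d
     else if m = 2 then cubic_coeff a c b d b d else cubic_coeff b d b d b d)"

text \<open>
  Expand the product of the forms \<open>r * P + R\<close>, \<open>s * P + R\<close>, \<open>t * P + R\<close> in powers of \<open>P\<close> and \<open>R\<close>.
\<close>
lemma cubic_coeff_basis:
  assumes "j < 4"
  shows "cubic_coeff (\<beta>1 * (r * a + b)) (\<beta>1 * (r * c + d)) (\<beta>2 * (s * a + b)) (\<beta>2 * (s * c + d)) (\<beta>3 * (t * a + b)) (\<beta>3 * (t * c + d)) j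
    = (\<beta>1 * \<beta>2 * \<beta>3) * (\<Sum>m<4. sym_coeff r s t m * basis_coeff a b c d m j)"
  using less_4_cases[OF assms]
  by (auto simp: cubic_coeff_def sym_coeff_def basis_coeff_def eval_nat_numeral algebra_simps)

text \<open>
  The determinant of the third symmetric power of a two-dimensional linear map is the sixth power of the
  determinant of that map.
\<close>
lemma det_basis_coeff:
  "Determinant.det (Matrix.mat 4 4 (\<lambda>(m, j). basis_coeff a b c d m j)) = (a * d - b * c) ^ 6"
  unfolding det_mat_4 by (simp add: basis_coeff_def cubic_coeff_def eval_nat_numeral algebra_simps)

lemma det_scaled_product:
  fixes f e g :: "nat \<Rightarrow> nat \<Rightarrow> complex"
  assumes "\<And>i j. i < 4 \<Longrightarrow> j < 4 \<Longrightarrow> f i j = s i * (\<Sum>m<4. e i m * g m j)"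
  shows "Determinant.det (Matrix.mat 4 4 (\<lambda>(i, j). f i j)) =
     (s 0 * s 1 * s 2 * s 3) * Determinant.det (Matrix.mat 4 4 (\<lambda>(i, j). e i j)) * Determinant.det (Matrix.mat 4 4 (\<lambda>(i, j). g i j))"
proof -
  have "Matrix.mat 4 4 (\<lambda>(i, j). f i j) = Matrix.mat 4 4 (\<lambda>(i, j). s i * e i j) * Matrix.mat 4 4 (\<lambda>(i, j). g i j)"
    by (rule eq_matI) (simp_all add: assms scalar_prod_def sum_distrib_left atLeast0LessThan mult.assoc)
  then have "Determinant.det (Matrix.mat 4 4 (\<lambda>(i, j). f i j)) = 
    Determinant.det (Matrix.mat 4 4 (\<lambda>(i, j). s i * e i j)) * Determinant.det (Matrix.mat 4 4 (\<lambda>(i, j). g i j))"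
    by (simp add: det_mult[of _ 4])
  also have "Determinant.det (Matrix.mat 4 4 (\<lambda>(i, j). s i * e i j)) = (s 0 * s 1 * s 2 * s 3) * Determinant.det (Matrix.mat 4 4 (\<lambda>(i, j). e i j))"
    unfolding det_mat_4 by (simp add: algebra_simps)
  finally show ?thesis .
qed

definition sym_row :: "(nat \<Rightarrow> nat \<Rightarrow> complex) \<Rightarrow> nat \<Rightarrow> nat \<Rightarrow> complex" where
  "sym_row f i = (if i = 0 then sym_coeff (f 1 2) (f 1 3) (f 1 4)
    else if i = 1 then sym_coeff (f 2 1) (f 2 3) (f 2 4) else if i = 2 then sym_coeff (f 3 1) (f 3 2) (f 3 4)
    else sym_coeff (f 4 1) (f 4 2) (f 4 3))"

section \<open>The determinant of the symmetric functions of the directions\<close>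

lemma of_real_inner_unit:
  assumes "cmod x = 1" "cmod y = 1"
  shows "complex_of_real (inner x y) = (x / y + y / x) / 2"
proof -
  have "x / y = x * cnj y" "y / x = y * cnj x"
    using assms by (simp_all add: divide_conv_cnj)
  then show ?thesis by (simp add: inner_complex_def complex_eq_iff)
qed

text \<open>
  For unit complex numbers, conjugation is inversion, so cosines of angles become rational functions. This lemma
  and the next one clear the denominators of the \<open>star\<close> and \<open>triangle\<close> terms.
\<close>
lemma star_poly:
  assumes "cmod x = 1" "cmod y = 1" "cmod z = 1"
  shows "2 * (x * y * z) * of_real (3 + inner x y + inner x z + inner y z)
    = (x + y) * (y + z) * (z + x) + 4 * x * y * z"
proof -
  have nz: "x \<noteq> 0" "y \<noteq> 0" "z \<noteq> 0" using assms by auto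
  have "2 * (x * y * z) * of_real (3 + inner x y + inner x z + inner y z)
     = 2 * (x * y * z) * (3 + (x / y + y / x) / 2 + (x / z + z / x) / 2 + (y / z + z / y) / 2)"
    by (simp only: of_real_add of_real_numeral of_real_inner_unit[OF assms(1,2)] of_real_inner_unit[OF assms(1,3)] of_real_inner_unit[OF assms(2,3)])
  also have "\<dots> = 6*x*y*z + x^2*z+y^2*z+x^2*y+z^2*y+y^2*x+z^2*x"
    using nz by (simp add: field_simps power2_eq_square)
  also have "\<dots> = (x + y) * (y + z) * (z + x) + 4 * x * y * z"
    by (simp add: algebra_simps power2_eq_square)
  finally show ?thesis .
qed

lemma triangle_poly:
  assumes "cmod x = 1" "cmod y = 1" "cmod z = 1"
  shows "2 * (x * y * z) * of_real (inner x y - inner x z + inner y z - 1)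
    = (x - y) * (z - y) * (x + z)"
proof -
  have nz: "x \<noteq> 0" "y \<noteq> 0" "z \<noteq> 0" using assms by auto
  have "2 * (x * y * z) * of_real (inner x y - inner x z + inner y z - 1)
     = 2 * (x * y * z) * ((x / y + y / x) / 2 - (x / z + z / x) / 2 + (y / z + z / y) / 2 - 1)"
    by (simp only: of_real_add of_real_diff of_real_1 of_real_inner_unit[OF assms(1,2)] of_real_inner_unit[OF assms(1,3)] of_real_inner_unit[OF assms(2,3)])
  also have "\<dots> = (x - y) * (z - y) * (x + z)"
    using nz by (simp add: field_simps power2_eq_square)
  finally show ?thesis .
qed

text \<open>
  Each product of a \<open>star\<close> and a \<open>triangle\<close> term absorbs the six directions: the three at the vertex clear the
  denominators of the first factor, the three in the opposite triangle those of the second. The signs arise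
  because the directions at the later vertices are reversed.
\<close>
lemma planar_det_collect:
  fixes a b c d e g :: complex
  shows "a * b * c * d * e * g * (64 + 4 * (S1 * T1 + S2 * T2 + S3 * T3 + S4 * T4) - 8 * X) = 64 * (a * b * c * d * e * g)
    + (2 * (a * b * c) * S1) * (2 * (d * e * g) * T1)
    - (2 * ((-a) * d * e) * S2) * (2 * (b * c * g) * T2)
    + (2 * ((-b) * (-d) * g) * S3) * (2 * (a * c * e) * T3)
    - (2 * ((-c) * (-e) * (-g)) * S4) * (2 * (a * b * d) * T4)
    - 4 * (2 * ((a * g) * (b * e) * (c * d)) * X)"
  by (simp add: algebra_simps)

text \<open>
  The four-by-three array \<open>r\<close> holds the elementary symmetric functions of positive degree for the directions that
  leave each of the four points; \<open>a\<close> to \<open>f\<close> are the directions 12, 13, 14, 23, 24, 34.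
\<close>
lemma symmetric_function_det:
  fixes a b c d e f :: complex
  assumes "r11 = a*b*c" "r12 = a*b + b*c + a*c" "r13 = a + b + c"
     "r21 = -a*d*e" "r22 = -a*d - a*e + d*e" "r23 = -a + d + e"
     "r31 = b*d*f" "r32 = b*d - b*f - d*f" "r33 = -b - d + f"
     "r41 = -c*e*f" "r42 = c*e + c*f + e*f" "r43 = -c - e - f"
  shows "(r11*r22-r12*r21)*(r33-r43) - (r11*r23-r13*r21)*(r32-r42) + (r11-r21)*(r32*r43-r33*r42)
     +(r12*r23-r13*r22)*(r31-r41) - (r12-r22)*(r31*r43-r33*r41) + (r13-r23)*(r31*r42-r32*r41)
   = 64 * (a*b*c*d*e*f)
     + ((a + b) * (b + c) * (c + a) + 4 * a * b * c) * ((d - e) * (f - e) * (d + f))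
     - ((-a + d) * (d + e) * (e + -a) + 4 * -a * d * e) * ((b - c) * (f - c) * (b + f))
     + ((-b + -d) * (-d + f) * (f + -b) + 4 * -b * -d * f) * ((a - c) * (e - c) * (a + e))
     - ((-c + -e) * (-e + -f) * (-f + -c) + 4 * -c * -e * -f) * ((a - b) * (d - b) * (a + d))
     - 4 * ((a*f - b*e) * (c*d - b*e) * (a*f + c*d))"
  unfolding assms by (simp add: algebra_simps)

lemma det_sym_row:
  assumes unit: "\<And>i j. i \<in> {1..4} \<Longrightarrow> j \<in> {1..4} \<Longrightarrow> i \<noteq> j \<Longrightarrow> cmod (f i j) = 1"
    and anti: "\<And>i j. f j i = - f i j"
  shows "Determinant.det (Matrix.mat 4 4 (\<lambda>(i, j). sym_row f i j)) =
    f 1 2 * f 1 3 * f 1 4 * f 2 3 * f 2 4 * f 3 4 * of_real (planar_det f 1 2 3 4)"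
proof -
  define a b c d e g where "a = f 1 2" and "b = f 1 3" and "c = f 1 4" and "d = f 2 3" and "e = f 2 4" and "g = f 3 4"
  have abc: "f 1 2 = a" "f 1 3 = b" "f 1 4 = c" "f 2 3 = d" "f 2 4 = e" "f 3 4 = g"
    "f 2 1 = - a" "f 3 1 = - b" "f 4 1 = - c" "f 3 2 = - d" "f 4 2 = - e" "f 4 3 = - g"
    using anti[of 1 2] anti[of 1 3] anti[of 1 4] anti[of 2 3] anti[of 2 4] anti[of 3 4]
    unfolding a_def b_def c_def d_def e_def g_def by simp_all
  have n: "cmod a = 1" "cmod b = 1" "cmod c = 1" "cmod d = 1" "cmod e = 1" "cmod g = 1"
    using unit unfolding a_def b_def c_def d_def e_def g_def by simp_all
  then have n': "cmod (-a) = 1" "cmod (-b) = 1" "cmod (-c) = 1" "cmod (-d) = 1" "cmod (-e) = 1" "cmod (-g) = 1"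
    "cmod (a * g) = 1" "cmod (b * e) = 1" "cmod (c * d) = 1"
    by (simp_all add: norm_mult)
  let ?S = "\<lambda>x y z. 3 + inner x y + inner x z + inner y z"
  let ?T = "\<lambda>x y z. inner x y - inner x z + inner y z - (1 :: real)"
  have star: "star_term f 1 2 3 4 = ?S a b c" "star_term f 2 1 3 4 = ?S (-a) d e"
    "star_term f 3 1 2 4 = ?S (-b) (-d) g" "star_term f 4 1 2 3 = ?S (-c) (-e) (-g)"
    unfolding star_term_def vertex_cos_def abc by simp_all
  have tri: "triangle_term f 2 3 4 = ?T d e g" "triangle_term f 1 3 4 = ?T b c g"
    "triangle_term f 1 2 4 = ?T a c e" "triangle_term f 1 2 3 = ?T a b d"
    unfolding triangle_term_def vertex_cos_def abc by simp_all
  have cross: "cross_term f 1 2 3 4 = ?T (a * g) (b * e) (c * d)"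
    unfolding cross_term_def abc by (simp add: inner_commute)
  have "of_real (planar_det f 1 2 3 4) = 64 + 4 * (
      of_real (?S a b c) * of_real (?T d e g) + of_real (?S (-a) d e) * of_real (?T b c g)
    + of_real (?S (-b) (-d) g) * of_real (?T a c e) + of_real (?S (-c) (-e) (-g)) * of_real (?T a b d))
    - 8 * complex_of_real (?T (a * g) (b * e) (c * d))"
    unfolding planar_det_def star tri cross
    by (simp only: of_real_add[of 64] of_real_add[of "_ * _"] of_real_add[of "_ + _" "_ * _"] of_real_diff[of _ "8 * _"] of_real_mult of_real_numeral)
  then have "a * b * c * d * e * g * of_real (planar_det f 1 2 3 4) = a * b * c * d * e * g * (64 + 4 * (
      of_real (?S a b c) * of_real (?T d e g) + of_real (?S (-a) d e) * of_real (?T b c g)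
    + of_real (?S (-b) (-d) g) * of_real (?T a c e) + of_real (?S (-c) (-e) (-g)) * of_real (?T a b d))
    - 8 * complex_of_real (?T (a * g) (b * e) (c * d)))"
    by (rule arg_cong)
  note det = this[unfolded planar_det_collect
      star_poly[OF n(1-3)] star_poly[OF n'(1) n(4,5)] star_poly[OF n'(2,4) n(6)] star_poly[OF n'(3,5,6)]
      triangle_poly[OF n(4-6)] triangle_poly[OF n(2,3,6)] triangle_poly[OF n(1,3,5)]
      triangle_poly[OF n(1,2,4)] triangle_poly[OF n'(7-9)]]
  have rows: "sym_row f 0 0 = a * b * c" "sym_row f 0 1 = a * b + b * c + a * c" "sym_row f 0 2 = a + b + c" "sym_row f 0 3 = 1"
    "sym_row f 1 0 = - a * d * e" "sym_row f 1 1 = - a * d - a * e + d * e" "sym_row f 1 2 = - a + d + e" "sym_row f 1 3 = 1"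
    "sym_row f 2 0 = b * d * g" "sym_row f 2 1 = b * d - b * g - d * g" "sym_row f 2 2 = - b - d + g" "sym_row f 2 3 = 1"
    "sym_row f 3 0 = - c * e * g" "sym_row f 3 1 = c * e + c * g + e * g" "sym_row f 3 2 = - c - e - g" "sym_row f 3 3 = 1"
    using abc by (simp_all add: sym_row_def sym_coeff_def)
  show ?thesis
    unfolding abc det det_mat_4 rows(4,8,12,16) mult_1_right mult_1_left
    by (rule symmetric_function_det[OF rows(1-3) rows(5-7) rows(9-11) rows(13-15)])
qed

text \<open>
  The coefficient matrix is a diagonal matrix of products of the \<open>\<beta> i j\<close>, times the matrix of symmetric functions
  of the \<open>f i j\<close>, times the matrix of the change of basis of cubic forms.
\<close>
lemma cmod_atiyah_det_planar:
  assumes \<beta>: "\<And>i j. i \<in> {1..4} \<Longrightarrow> j \<in> {1..4} \<Longrightarrow> i \<noteq> j \<Longrightarrow> cmod (\<beta> i j) = 1 / sqrt 2"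
    and z: "\<And>i j. i \<in> {1..4} \<Longrightarrow> j \<in> {1..4} \<Longrightarrow> i \<noteq> j \<Longrightarrow> z i j = \<beta> i j * (f i j * a + b)"
    and w: "\<And>i j. i \<in> {1..4} \<Longrightarrow> j \<in> {1..4} \<Longrightarrow> i \<noteq> j \<Longrightarrow> w i j = \<beta> i j * (f i j * c + d)"
    and unit: "\<And>i j. i \<in> {1..4} \<Longrightarrow> j \<in> {1..4} \<Longrightarrow> i \<noteq> j \<Longrightarrow> cmod (f i j) = 1"
    and anti: "\<And>i j. f j i = - f i j"
    and basis: "cmod (a * d - b * c) = 1"
  shows "cmod (atiyah_det 4 z w) = \<bar>planar_det f 1 2 3 4\<bar> / 64"
proof -
  define s where "s i = (if i = 0 then \<beta> 1 2 * \<beta> 1 3 * \<beta> 1 4 else if i = 1 then \<beta> 2 1 * \<beta> 2 3 * \<beta> 2 4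
    else if i = 2 then \<beta> 3 1 * \<beta> 3 2 * \<beta> 3 4 else \<beta> 4 1 * \<beta> 4 2 * \<beta> 4 3)" for i :: nat
  have others: "{1..4} - {Suc 0} = {2, 3, 4 :: nat}" "{1..4} - {2} = {1, 3, 4 :: nat}"
    "{1..4} - {3} = {1, 2, 4 :: nat}" "{1..4} - {4} = {1, 2, 3 :: nat}" by auto
  have rows: "atiyah_coeff 4 z w (i + 1) (j + 1) = s i * (\<Sum>m<4. sym_row f i m * basis_coeff a b c d m j)"
    if "i < 4" "j < 4" for i j
  proof -
    have row: "atiyah_coeff 4 z w i' (j + 1) 
        = (\<beta> i' k * \<beta> i' l * \<beta> i' m) * (\<Sum>n<4. sym_coeff (f i' k) (f i' l) (f i' m) n * basis_coeff a b c d n j)"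
      if "{1..4} - {i'} = {k, l, m}" "distinct [k, l, m]" "i' \<in> {1..4}" for i' k l m
    proof -
      have "k \<in> {1..4} - {i'}" "l \<in> {1..4} - {i'}" "m \<in> {1..4} - {i'}" unfolding that(1) by auto
      then have "i' \<noteq> k" "i' \<noteq> l" "i' \<noteq> m" "k \<in> {1..4}" "l \<in> {1..4}" "m \<in> {1..4}" by auto
      then have factors: "z i' k = \<beta> i' k * (f i' k * a + b)" "w i' k = \<beta> i' k * (f i' k * c + d)"
        "z i' l = \<beta> i' l * (f i' l * a + b)" "w i' l = \<beta> i' l * (f i' l * c + d)"
        "z i' m = \<beta> i' m * (f i' m * a + b)" "w i' m = \<beta> i' m * (f i' m * c + d)"
        using z w that(3) by blast+
      show ?thesis
        unfolding atiyah_coeff_cubic[OF that(1,2) \<open>j < 4\<close>] factors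
        by (rule cubic_coeff_basis[OF \<open>j < 4\<close>])
    qed
    from less_4_cases[OF \<open>i < 4\<close>] show ?thesis
    proof (elim disjE)
      assume "i = 0" then show ?thesis using row[OF others(1)] by (simp add: s_def sym_row_def)
    next
      assume "i = 1" then show ?thesis using row[OF others(2)] by (simp add: s_def sym_row_def numeral_2_eq_2)
    next
      assume "i = 2" then show ?thesis using row[OF others(3)] by (simp add: s_def sym_row_def)
    next
      assume "i = 3" then show ?thesis using row[OF others(4)] by (simp add: s_def sym_row_def)
    qed
  qed
  have sym: "Determinant.det (Matrix.mat 4 4 (\<lambda>(i, j). sym_row f i j)) =
    f 1 2 * f 1 3 * f 1 4 * f 2 3 * f 2 4 * f 3 4 * of_real (planar_det f 1 2 3 4)"
    by (rule det_sym_row[OF unit anti])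
  have "atiyah_det 4 z w = (s 0 * s 1 * s 2 * s 3)
     * (f 1 2 * f 1 3 * f 1 4 * f 2 3 * f 2 4 * f 3 4 * of_real (planar_det f 1 2 3 4)) * (a * d - b * c) ^ 6"
    unfolding atiyah_det_def
    by (subst det_scaled_product[OF rows]) (simp_all only: sym det_basis_coeff)
  moreover have "cmod (s 0 * s 1 * s 2 * s 3) = (1 / sqrt 2) ^ 12"
  proof -
    have "cmod (s 0) = (1 / sqrt 2) ^ 3" "cmod (s 1) = (1 / sqrt 2) ^ 3"
      "cmod (s 2) = (1 / sqrt 2) ^ 3" "cmod (s 3) = (1 / sqrt 2) ^ 3"
      by (simp_all add: s_def norm_mult \<beta> power3_eq_cube)
    then have "cmod (s 0 * s 1 * s 2 * s 3) = (1 / sqrt 2) ^ (3 + 3 + 3 + 3)"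
      unfolding norm_mult power_add by (simp only:)
    then show ?thesis by simp
  qed
  moreover have "(1 / sqrt 2) ^ 12 = 1 / (64 :: real)"
  proof -
    have "(1 / sqrt 2) ^ 12 = ((1 / sqrt 2)\<^sup>2) ^ (6 :: nat)" by (simp flip: power_mult)
    then show ?thesis by (simp add: power_divide)
  qed
  ultimately show ?thesis using unit basis by (simp add: norm_mult norm_power)
qed

section \<open>The diagonals of a convex quadrilateral in space\<close>

lemma extreme_point_notin_hull:
  assumes "convex Q" "v extreme_point_of Q" "T \<subseteq> Q" "v \<notin> T"
  shows "v \<notin> convex hull T"
proof -
  have "convex (Q - {v})" using assms extreme_point_of_stillconvex by blast
  then have "convex hull T \<subseteq> Q - {v}" using assms by (intro hull_minimal) auto
  then show ?thesis by blast
qed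

text \<open>
  Four points of a plane are affinely dependent, so by Radon's theorem they split into two sets with intersecting
  convex hulls. An extreme point is outside the hull of the others, so each set has two elements, and the
  common point \<open>e\<close> is interior to both segments. If the segments were parallel, all four points would be
  collinear.
\<close>
lemma convex_quadrilateral_diagonals:
  assumes "convex_quadrilateral Q"
  obtains A B C D e u v a b c d where "{x. x extreme_point_of Q} = {A, B, C, D}"
    "a > 0" "b > 0" "c > 0" "d > 0"
    "A = e - a *\<^sub>R u" "B = e - b *\<^sub>R v" "C = e + c *\<^sub>R u" "D = e + d *\<^sub>R v"
    "u \<noteq> 0" "\<And>t. v \<noteq> t *\<^sub>R u"
proof -
  define S where "S = {x. x extreme_point_of Q}"
  have Q: "polytope Q" "aff_dim Q = 2" and card: "card S = 4"
    using assms by (auto simp: convex_quadrilateral_def S_def)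
  then have conv: "convex Q" and "compact Q" by (auto simp: polytope_imp_convex polytope_imp_compact)
  then have hull: "Q = convex hull S" unfolding S_def by (intro Krein_Milman_Minkowski)
  have fin: "finite S" using card card_ge_0_finite by force
  have SQ: "S \<subseteq> Q" unfolding S_def extreme_point_of_def by blast
  have dim: "aff_dim S = 2" using Q hull by (metis aff_dim_convex_hull)
  then have "affine_dependent S" using card affine_independent_iff_card[of S] by auto
  then obtain M P where MP: "M \<inter> P = {}" "M \<union> P = S" "convex hull M \<inter> convex hull P \<noteq> {}"
    using Radon_partition[OF fin] by blast
  then obtain e where e: "e \<in> convex hull M" "e \<in> convex hull P" by blast
  have notin: "x \<notin> convex hull T" if "x \<in> S" "T \<subseteq> S" "x \<notin> T" for x T
    using that SQ conv by (intro extreme_point_notin_hull[of Q]) (auto simp: S_def)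
  have finMP: "finite M" "finite P" using MP fin by (auto intro: finite_subset)
  have big: "2 \<le> card M" if "M \<inter> P = {}" "M \<union> P = S" "e \<in> convex hull M" "e \<in> convex hull P" "finite M" for M P
  proof (rule ccontr)
    assume "\<not> 2 \<le> card M"
    then have "card M = 0 \<or> card M = 1" by linarith
    then show False
    proof
      assume "card M = 0"
      then show False using that by simp
    next
      assume "card M = 1"
      then obtain x where "M = {x}" by (auto simp: card_1_singleton_iff)
      then show False using that notin[of x P] by auto
    qed
  qed
  have "2 \<le> card M" "2 \<le> card P" using big[of M P] big[of P M] MP e finMP by (auto simp: Int_commute Un_commute)
  moreover have "card M + card P = 4" using card_Un_disjoint[of M P] MP finMP card by simp
  ultimately have "card M = 2" "card P = 2" by simp_all
  then obtain A C B D where M: "M = {A, C}" "A \<noteq> C" and P: "P = {B, D}" "B \<noteq> D"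
    by (auto simp: card_2_iff)
  have inner_segment: "\<exists>t. 0 < t \<and> t < 1 \<and> e = (1 - t) *\<^sub>R Y + t *\<^sub>R Z"
    if "e \<in> convex hull {Y, Z}" "e \<in> convex hull T" "Y \<in> S" "Z \<in> S" "Y \<notin> T" "Z \<notin> T" "T \<subseteq> S" for Y Z T
  proof -
    have "e \<noteq> Y" "e \<noteq> Z" using notin that by auto
    moreover have "e \<in> closed_segment Y Z" using that by (simp add: segment_convex_hull)
    ultimately have "e \<in> open_segment Y Z" by (simp add: open_segment_def)
    then show ?thesis by (auto simp: in_segment)
  qed
  have mem: "A \<in> S" "C \<in> S" "B \<in> S" "D \<in> S" "A \<notin> P" "C \<notin> P" "B \<notin> M" "D \<notin> M" "M \<subseteq> S" "P \<subseteq> S" 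
    using MP M P by auto
  obtain s where s: "0 < s" "s < 1" "e = (1 - s) *\<^sub>R A + s *\<^sub>R C"
    using inner_segment[of A C P] e mem M(1) by auto
  obtain t where t: "0 < t" "t < 1" "e = (1 - t) *\<^sub>R B + t *\<^sub>R D"
    using inner_segment[of B D M] e mem P(1) by auto
  have eqs: "A = e - s *\<^sub>R (C - A)" "C = e + (1 - s) *\<^sub>R (C - A)"
     "B = e - t *\<^sub>R (D - B)" "D = e + (1 - t) *\<^sub>R (D - B)"
  proof -
    show "A = e - s *\<^sub>R (C - A)" "C = e + (1 - s) *\<^sub>R (C - A)"
      unfolding s(3) by (simp_all add: algebra_simps)
    show "B = e - t *\<^sub>R (D - B)" "D = e + (1 - t) *\<^sub>R (D - B)"
      unfolding t(3) by (simp_all add: algebra_simps)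
  qed
  have "D - B \<noteq> r *\<^sub>R (C - A)" for r
  proof
    assume r: "D - B = r *\<^sub>R (C - A)"
    have "\<exists>q. X = e + q *\<^sub>R (C - A)" if "X \<in> S" for X
    proof -
      have "X \<in> {A, C, B, D}" using that MP M P by auto
      moreover have "A = e + (- s) *\<^sub>R (C - A)" using eqs(1) by simp
      moreover have "B = e + (- t * r) *\<^sub>R (C - A)" "D = e + ((1 - t) * r) *\<^sub>R (C - A)" 
        using eqs(3,4) unfolding r by simp_all
      ultimately show ?thesis using eqs(2) by (elim insertE emptyE; metis)
    qed
    then obtain q where q: "X = e + q X *\<^sub>R (C - A)" if "X \<in> S" for X by metis
    have "X - Y = (q X - q Y) *\<^sub>R (C - A)" if "X \<in> S" "Y \<in> S" for X Y
      by (subst q[OF that(1)], subst q[OF that(2)]) (simp add: scaleR_left_diff_distrib)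
    then have "collinear S" unfolding collinear_def by blast
    then show False using dim collinear_aff_dim[of S] by simp
  qed
  moreover have "S = {A, B, C, D}" using MP M P by auto
  ultimately show ?thesis
    using that[of A B C D s t "1 - s" "1 - t" e "C - A" "D - B"] eqs s t M(2) unfolding S_def by auto
qed

lemma plane_normal_exists:
  fixes u v :: "real ^ 3"
  obtains n where "norm n = 1" "inner n u = 0" "inner n v = 0"
proof -
  have "dim {u, v} \<le> card {u, v}" by (intro dim_le_card) (auto simp: span_superset)
  also have "\<dots> \<le> 2" by (simp add: card_insert_if)
  finally have "dim {u, v} < DIM(real ^ 3)" by simp
  then obtain n where n: "n \<noteq> 0" "\<And>y. y \<in> span {u, v} \<Longrightarrow> inner n y = 0"
    by (rule orthogonal_to_subspace_exists[unfolded real_inner_class.orthogonal_def]) blast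
  then have "inner n u = 0" "inner n v = 0"
    by (auto simp: span_base)
  then show ?thesis using n(1) that[of "sgn n"] by (simp add: norm_sgn sgn_div_norm)
qed

text \<open>
  A linear relation between the images would lift to \<open>u\<close> and \<open>v\<close>, since the map is isometric on the plane.
\<close>
lemma plane_coord_independent:
  assumes p: "spinor_of p q n" and u: "inner n u = 0" "u \<noteq> 0" and v: "inner n v = 0" "\<And>t. v \<noteq> t *\<^sub>R u"
  shows "Im (plane_coord p q v * cnj (plane_coord p q u)) \<noteq> 0"
proof
  define U V where "U = plane_coord p q u" and "V = plane_coord p q v"
  assume "Im (plane_coord p q v * cnj (plane_coord p q u)) = 0"
  then have im: "Im (V * cnj U) = 0" by (simp add: U_def V_def)
  have "cmod U = norm u" unfolding U_def by (rule norm_plane_coord[OF p u(1)])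
  then have "U \<noteq> 0" using u by auto
  define t where "t = Re (V * cnj U) / (cmod U)\<^sup>2"
  have "V * (U * cnj U) = of_real (Re (V * cnj U)) * U"
    using im by (simp add: complex_eq_iff algebra_simps)
  then have "V = of_real t * U"
    using \<open>U \<noteq> 0\<close> unfolding t_def complex_norm_square[symmetric] by (simp add: field_simps)
  then have "plane_coord p q (v - t *\<^sub>R u) = 0"
    unfolding U_def V_def
    by (simp add: linear_diff[OF linear_plane_coord] linear_cmul[OF linear_plane_coord] scaleR_conv_of_real[where 'a=complex])
  moreover have "inner n (v - t *\<^sub>R u) = 0" using u v by (simp add: inner_diff_right)
  ultimately have "norm (v - t *\<^sub>R u) = 0" using norm_plane_coord[OF p] by (metis norm_zero)
  then show False using v(2)[of t] by simp
qed

section \<open>Convex quadrilaterals\<close>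

theorem theorem3p12:
  fixes x :: "nat \<Rightarrow> real ^ 3"
    and Q :: "(real ^ 3) set"
    and z w :: "nat \<Rightarrow> nat \<Rightarrow> complex"
  assumes "convex_quadrilateral Q"
    and "{v. v extreme_point_of Q} = {x 1, x 2, x 3, x 4}"
    and "atiyah_choice 4 x z w"
  shows "cmod (atiyah_det 4 z w) \<ge> 1"
proof -
  have set4: "{1..4} = {1, 2, 3, 4 :: nat}" by auto
  obtain A B C D e u v a b c d where ext: "{x. x extreme_point_of Q} = {A, B, C, D}"
    and pos: "a > 0" "b > 0" "c > 0" "d > 0"
    and pts: "A = e - a *\<^sub>R u" "B = e - b *\<^sub>R v" "C = e + c *\<^sub>R u" "D = e + d *\<^sub>R v"
    and uv: "u \<noteq> 0" "\<And>t. v \<noteq> t *\<^sub>R u"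
    using convex_quadrilateral_diagonals[OF assms(1)] by metis
  have im: "x ` {1..4} = {A, B, C, D}" using assms(2) ext unfolding set4 by simp
  have "card (x ` {1..4}) = card {1..4 :: nat}" 
    using assms(1) unfolding im ext[symmetric] convex_quadrilateral_def by simp
  then have inj: "inj_on x {1..4}" by (rule eq_card_imp_inj_on[rotated]) simp
  obtain n where n: "norm n = 1" "inner n u = 0" "inner n v = 0" by (rule plane_normal_exists)
  obtain p q where p: "spinor_of p q n" using spinor_exists[OF n(1)] .
  define X where "X i = plane_coord p q (x i)" for i
  define f where "f i j = sgn (X j - X i)" for i j
  have anti: "f j i = - f i j" for i j unfolding f_def by (metis minus_diff_eq sgn_minus)
  have perp: "inner n (x j - x i) = 0" if "i \<in> {1..4}" "j \<in> {1..4}" for i j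
  proof -
    have "inner n y = inner n e" if "y \<in> {A, B, C, D}" for y
      using that n unfolding pts by (auto simp: inner_diff_right inner_add_right)
    moreover have "x i \<in> {A, B, C, D}" "x j \<in> {A, B, C, D}" using that im by blast+
    ultimately have "inner n (x i) = inner n (x j)" by metis
    then show ?thesis by (simp add: inner_diff_right)
  qed
  have spinors: "\<exists>\<beta>. cmod \<beta> = 1 / sqrt 2 \<and> cmod (f i j) = 1
      \<and> z i j = \<beta> * (f i j * p + (- cnj q)) \<and> w i j = \<beta> * (f i j * q + cnj p)"
    if "i \<in> {1..4}" "j \<in> {1..4}" "i \<noteq> j" for i j
  proof -
    have "x i \<noteq> x j" using inj that by (meson inj_onD)
    then have s: "spinor_of (z i j) (w i j) (sgn (x j - x i))"
      using atiyah_choice_spinor[OF assms(3)] that by blast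
    have "f i j = plane_coord p q (sgn (x j - x i))"
      unfolding plane_coord_sgn[OF p perp[OF that(1,2)]] by (simp add: f_def X_def linear_diff[OF linear_plane_coord])
    moreover have "inner n (sgn (x j - x i)) = 0" using perp[OF that(1,2)] by (simp add: sgn_div_norm)
    ultimately show ?thesis using spinor_in_plane[OF s p] by (metis diff_conv_add_uminus)
  qed
  define \<beta> where "\<beta> i j = (SOME \<beta>. cmod \<beta> = 1 / sqrt 2 \<and> cmod (f i j) = 1
      \<and> z i j = \<beta> * (f i j * p + (- cnj q)) \<and> w i j = \<beta> * (f i j * q + cnj p))" for i j
  have \<beta>: "cmod (\<beta> i j) = 1 / sqrt 2 \<and> cmod (f i j) = 1
      \<and> z i j = \<beta> i j * (f i j * p + (- cnj q)) \<and> w i j = \<beta> i j * (f i j * q + cnj p)"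
    if "i \<in> {1..4}" "j \<in> {1..4}" "i \<noteq> j" for i j
    unfolding \<beta>_def by (rule someI_ex) (rule spinors[OF that])
  have "p * cnj p - - cnj q * q = 1" using p by (simp add: spinor_of_def mult.commute)
  then have basis: "cmod (p * cnj p - - cnj q * q) = 1" by simp
  have det: "cmod (atiyah_det 4 z w) = \<bar>planar_det f 1 2 3 4\<bar> / 64"
    by (rule cmod_atiyah_det_planar[OF _ _ _ _ anti basis]) (use \<beta> in blast)+
  have "A \<in> x ` {1..4}" "B \<in> x ` {1..4}" "C \<in> x ` {1..4}" "D \<in> x ` {1..4}"
    unfolding im by simp_all
  then obtain i j k l where ijkl: "i \<in> {1..4}" "j \<in> {1..4}" "k \<in> {1..4}" "l \<in> {1..4}"
    "x i = A" "x j = B" "x k = C" "x l = D"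
    by (elim imageE) metis
  have "x ` {i, j, k, l} = x ` {1..4}"
    unfolding im image_insert image_empty ijkl(5-8) ..
  then have "{i, j, k, l} = {1..4}"
    by (subst (asm) inj_on_image_eq_iff[OF inj]) (use ijkl(1-4) in blast)+
  then have perm: "planar_det f i j k l = planar_det f 1 2 3 4"
    unfolding set4 by (rule planar_det_permute[OF anti])
  have "planar_det f i j k l \<ge> 64"
  proof (rule planar_det_crossing[OF f_def])
    show "Im (plane_coord p q v * cnj (plane_coord p q u)) \<noteq> 0"
      by (rule plane_coord_independent[OF p n(2) uv(1) n(3) uv(2)])
    show "X i = plane_coord p q e - of_real a * plane_coord p q u" 
      "X j = plane_coord p q e - of_real b * plane_coord p q v"
      "X k = plane_coord p q e + of_real c * plane_coord p q u"
      "X l = plane_coord p q e + of_real d * plane_coord p q v"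
      unfolding X_def ijkl pts
      by (simp_all add: linear_diff[OF linear_plane_coord] linear_add[OF linear_plane_coord] linear_cmul[OF linear_plane_coord] scaleR_conv_of_real[where 'a=complex])
  qed (use pos in auto)
  then show ?thesis unfolding det perm by simp
qed

end
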